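(* Every strongly connected bridgeless mixed multigraph of diameter $d$ has oriented diameter at most $3d^2 + 2d + 2$.
   Context: A mixed multigraph is a finite multigraph in which each edge may be either directed or undirected. A walk from $v_1$ to $v_k$ is a sequence of vertices $v_1,\dots,v_k$ such that for each $i \in \{1,\dots,k-1\}$ there is either an undirected edge $\{v_i,v_{i+1}\}$ or an edge directed from $v_i$ to $v_{i+1}$. A trail is a walk without repeated edges; a path is a trail without repeated vertices, except possibly $v_1=v_k$. The length of a path is its number of edges (directed and undirected). A mixed multigraph is strongly connected if there is a path from each vertex to every other vertex. A bridge in a strongly connected mixed multigraph is an undirected edge whose removal makes the graph no longer strongly connected; the graph is bridgeless if it has no bridge. An orientation of a mixed multigraph $G$ is an assignment of exactly one direction to each undirected edge of $G$ (directed edges keep their direction); the result is a directed multigraph. The distance $d_G(u,v)$ is the length of a shortest path from $u$ to $v$. The eccentricity of a vertex $u$ is $e(u)=\max\{\max_{v} d_G(u,v),\ \max_{v} d_G(v,u)\}$, and the diameter of $G$ is $\max_{u\in V(G)} e(u)$ (infinite if $G$ is not strongly connected). The oriented diameter of $G$ is the minimum diameter of an orientation of $G$. *)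

theory Defs
  imports Main "HOL-Library.Extended_Nat" "HOL-Library.Uprod"
begin

text \<open>
  Edges are abstract labels, so parallel edges are distinct labels with the same link.
  An undirected loop at \<open>v\<close> is \<open>Undirected (Upair v v)\<close>.
\<close>

datatype (set_link: 'v) link = is_Undirected: Undirected "'v uprod" | Directed 'v 'v

record ('v, 'e) pre_mixed_multigraph =
  verts :: "'v set"
  edges :: "'e set"
  link :: "'e \<Rightarrow> 'v link"

locale mixed_multigraph =
  fixes G :: "('v, 'e) pre_mixed_multigraph"
  assumes finite_verts: "finite (verts G)"
    and verts_nonempty: "verts G \<noteq> {}"
    and finite_edges: "finite (edges G)"
    and link_wf: "\<And>e. e \<in> edges G \<Longrightarrow> set_link (link G e) \<subseteq> verts G"

definition traverses :: "('v, 'e) pre_mixed_multigraph \<Rightarrow> 'e \<Rightarrow> 'v \<Rightarrow> 'v \<Rightarrow> bool" where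
  "traverses G e u v \<longleftrightarrow>
    e \<in> edges G \<and> (link G e = Undirected (Upair u v) \<or> link G e = Directed u v)"

text \<open>
  In a multigraph the vertex sequence does not determine the edges used, so a walk carries
  both: its vertices \<open>vs\<close> and its edges \<open>es\<close>. A single vertex is a walk of length 0.
\<close>

definition walk :: "('v, 'e) pre_mixed_multigraph \<Rightarrow> 'v list \<Rightarrow> 'e list \<Rightarrow> bool" where
  "walk G vs es \<longleftrightarrow>
    length vs = Suc (length es) \<and> set vs \<subseteq> verts G \<and>
    (\<forall>i < length es. traverses G (es ! i) (vs ! i) (vs ! Suc i))"

definition trail :: "('v, 'e) pre_mixed_multigraph \<Rightarrow> 'v list \<Rightarrow> 'e list \<Rightarrow> bool" where
  "trail G vs es \<longleftrightarrow> walk G vs es \<and> distinct es"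

definition path :: "('v, 'e) pre_mixed_multigraph \<Rightarrow> 'v list \<Rightarrow> 'e list \<Rightarrow> bool" where
  "path G vs es \<longleftrightarrow>
    trail G vs es \<and>
    (\<forall>i j. i < j \<and> j < length vs \<and> vs ! i = vs ! j \<longrightarrow> i = 0 \<and> j = length vs - 1)"

definition path_betw ::
  "('v, 'e) pre_mixed_multigraph \<Rightarrow> 'v \<Rightarrow> 'v list \<Rightarrow> 'e list \<Rightarrow> 'v \<Rightarrow> bool" where
  "path_betw G u vs es v \<longleftrightarrow> path G vs es \<and> hd vs = u \<and> last vs = v"

definition strongly_connected :: "('v, 'e) pre_mixed_multigraph \<Rightarrow> bool" where
  "strongly_connected G \<longleftrightarrow>
    (\<forall>u \<in> verts G. \<forall>v \<in> verts G. u \<noteq> v \<longrightarrow> (\<exists>vs es. path_betw G u vs es v))"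

definition remove_edge ::
  "('v, 'e) pre_mixed_multigraph \<Rightarrow> 'e \<Rightarrow> ('v, 'e) pre_mixed_multigraph" where
  "remove_edge G e = G\<lparr>edges := edges G - {e}\<rparr>"

definition bridge :: "('v, 'e) pre_mixed_multigraph \<Rightarrow> 'e \<Rightarrow> bool" where
  "bridge G e \<longleftrightarrow>
    e \<in> edges G \<and> is_Undirected (link G e) \<and> \<not> strongly_connected (remove_edge G e)"

definition bridgeless :: "('v, 'e) pre_mixed_multigraph \<Rightarrow> bool" where
  "bridgeless G \<longleftrightarrow> (\<nexists>e. bridge G e)"

text \<open>The infimum of the empty set in \<^typ>\<open>enat\<close> is \<open>\<infinity>\<close>; any other infimum is attained.\<close>

definition distance :: "('v, 'e) pre_mixed_multigraph \<Rightarrow> 'v \<Rightarrow> 'v \<Rightarrow> enat" where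
  "distance G u v = Inf {enat (length es) | vs es. path_betw G u vs es v}"

definition eccentricity :: "('v, 'e) pre_mixed_multigraph \<Rightarrow> 'v \<Rightarrow> enat" where
  "eccentricity G u =
    max (Max ((\<lambda>v. distance G u v) ` verts G)) (Max ((\<lambda>v. distance G v u) ` verts G))"

definition diameter :: "('v, 'e) pre_mixed_multigraph \<Rightarrow> enat" where
  "diameter G = Max (eccentricity G ` verts G)"

definition orientation ::
  "('v, 'e) pre_mixed_multigraph \<Rightarrow> ('v, 'e) pre_mixed_multigraph \<Rightarrow> bool" where
  "orientation G H \<longleftrightarrow>
    verts H = verts G \<and> edges H = edges G \<and>
    (\<forall>e \<in> edges G. case link G e of
        Undirected p \<Rightarrow> (\<exists>u v. p = Upair u v \<and> link H e = Directed u v)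
      | Directed u v \<Rightarrow> link H e = Directed u v)"

definition oriented_diameter :: "('v, 'e) pre_mixed_multigraph \<Rightarrow> enat" where
  "oriented_diameter G = Inf {diameter H | H. orientation G H}"

end

theory Submission imports Defs begin

text \<open>
  Fix a vertex \<open>u\<close> and grow an oriented core \<open>W\<close>, starting from \<open>{u}\<close>. If every vertex is within
  distance \<open>r\<close> of \<open>W\<close> in both directions, comparing breadth-first distances with and without the
  edge shows that every undirected edge leaving \<open>W\<close> lies on an ear of length at
  most \<open>2 r + 1\<close>, in one direction or the other.

  Choose a set \<open>S\<close> of undirected boundary edges to be oriented into \<open>W\<close>, such that the outer ends
  of all inward edges are still within distance \<open>2 r\<close> from \<open>W\<close>; a shortest path forest
  to these ends is added first. When \<open>S\<close> is maximal (for its size plus the number of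
  its edges on which no such ear starts), every remaining neighbour of \<open>W\<close> reaches
  the first forest in at most \<open>2 r - 1\<close> steps outside \<open>W\<close>, and a second forest
  collects these neighbours. Now all neighbours of \<open>W\<close> are in the core, \<open>r\<close> drops by one, and
  the distances in the core from and to \<open>u\<close> have grown by at most \<open>2 r\<close> and \<open>4 r - 1\<close>. Summing over
  \<open>r \<le> d\<close> gives \<open>d\<^sup>2 + d\<close> and \<open>2 d\<^sup>2 + d\<close>.
\<close>

section \<open>Arc sets\<close>

text \<open>A mixed multigraph is represented by its set of arcs \<open>(e, a, b)\<close>, an undirected edge
  contributing both of its directions.\<close>

type_synonym ('e, 'v) arcs = "('e \<times> 'v \<times> 'v) set"

section \<open>Reachability in labelled arc sets\<close>

text \<open>Bounding the length instead of fixing it makes the notion monotone in \<open>n\<close>.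
  Labels are dropped, because lengths do not depend on which parallel edge is taken.\<close>

definition reaches :: "('e, 'v) arcs \<Rightarrow> nat \<Rightarrow> 'v \<Rightarrow> 'v \<Rightarrow> bool" where
  "reaches R n x y \<longleftrightarrow> (\<exists>m\<le>n. (x, y) \<in> (snd ` R) ^^ m)"

definition opposite :: "('e, 'v) arcs \<Rightarrow> ('e, 'v) arcs" where
  "opposite R = {(e, b, a) | e a b. (e, a, b) \<in> R}"

text \<open>The abstract trace of a label having a single link. Both directions of an undirected
  edge remain possible; \<open>oriented\<close> is the condition that rules them out.\<close>

definition link_unique :: "('e, 'v) arcs \<Rightarrow> bool" where
  "link_unique R \<longleftrightarrow>
    (\<forall>e a b c d. (e, a, b) \<in> R \<and> (e, c, d) \<in> R \<longrightarrow> (c = a \<and> d = b) \<or> (c = b \<and> d = a))"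

definition oriented :: "('e, 'v) arcs \<Rightarrow> bool" where
  "oriented R \<longleftrightarrow> (\<forall>e p q. (e, p) \<in> R \<and> (e, q) \<in> R \<longrightarrow> p = q)"

lemma reaches_refl [simp]: "reaches R n x x"
  unfolding reaches_def by (rule exI[of _ 0]) auto

lemma reaches_arc:
  assumes "(e, x, y) \<in> R" "0 < n"
  shows "reaches R n x y"
proof -
  have "(x, y) \<in> snd ` R"
    using assms(1) by force
  then show ?thesis
    unfolding reaches_def using assms(2) by (intro exI[of _ 1]) auto
qed

lemma relpow_subset:
  fixes A B :: "('a \<times> 'a) set"
  shows "(x, y) \<in> A ^^ n \<Longrightarrow> A \<subseteq> B \<Longrightarrow> (x, y) \<in> B ^^ n"
  by (induction n arbitrary: y) auto

lemma reaches_mono: "reaches R n x y \<Longrightarrow> R \<subseteq> R' \<Longrightarrow> n \<le> n' \<Longrightarrow> reaches R' n' x y"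
  unfolding reaches_def by (meson image_mono order_trans relpow_subset)

lemma reaches_trans:
  assumes "reaches R m x y" "reaches R n y z" "m + n \<le> k"
  shows "reaches R k x z"
proof -
  obtain i j where "i \<le> m" "(x, y) \<in> (snd ` R) ^^ i" "j \<le> n" "(y, z) \<in> (snd ` R) ^^ j"
    using assms(1,2) unfolding reaches_def by blast
  then show ?thesis
    unfolding reaches_def using assms(3) by (intro exI[of _ "i + j"]) (auto intro: relpow_trans)
qed

lemma relpow_converse:
  fixes A :: "('a \<times> 'a) set"
  shows "(x, y) \<in> (A\<inverse>) ^^ n \<longleftrightarrow> (y, x) \<in> A ^^ n"
proof (induction n arbitrary: x y)
  case (Suc n)
  show ?case
  proof
    assume "(x, y) \<in> (A\<inverse>) ^^ Suc n"
    then obtain z where "(x, z) \<in> A\<inverse> ^^ n" "(y, z) \<in> A"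
      by auto
    then show "(y, x) \<in> A ^^ Suc n"
      using Suc by (meson relpow_Suc_I2)
  next
    assume "(y, x) \<in> A ^^ Suc n"
    then obtain z where "(y, z) \<in> A" "(z, x) \<in> A ^^ n"
      by (meson relpow_Suc_D2)
    then show "(x, y) \<in> (A\<inverse>) ^^ Suc n"
      using Suc by auto
  qed
qed auto

lemma snd_opposite: "snd ` opposite R = (snd ` R)\<inverse>"
  unfolding opposite_def by force

lemma in_opposite [simp]: "(e, a, b) \<in> opposite R \<longleftrightarrow> (e, b, a) \<in> R"
  unfolding opposite_def by auto

lemma opposite_opposite [simp]: "opposite (opposite R) = R"
  unfolding opposite_def by auto

lemma opposite_mono: "R \<subseteq> R' \<Longrightarrow> opposite R \<subseteq> opposite R'"
  unfolding opposite_def by auto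

lemma reaches_opposite [simp]: "reaches (opposite R) n x y \<longleftrightarrow> reaches R n y x"
  unfolding reaches_def snd_opposite relpow_converse ..

lemma link_unique_opposite [simp]: "link_unique (opposite R) \<longleftrightarrow> link_unique R"
  unfolding link_unique_def by (auto; blast)

lemma oriented_opposite [simp]: "oriented (opposite R) \<longleftrightarrow> oriented R"
  unfolding oriented_def by (auto; blast)

lemma link_unique_subset: "link_unique R \<Longrightarrow> R' \<subseteq> R \<Longrightarrow> link_unique R'"
  unfolding link_unique_def by blast

section \<open>Shortest path forests\<close>

text \<open>A breadth-first forest rooted in \<open>X\<close>, pruned to the branches that lead to
  \<open>M\<close>. Distance from \<open>X\<close> grows by one along each forest arc, so no edge is
  used in both directions. Each kept vertex lies on a forest path to \<open>M\<close> of length at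
  most \<open>K\<close>, which explains \<open>i + j\<close>.\<close>

lemma shortest_path_forest:
  fixes T :: "('e, 'v) arcs"
  assumes uniq: "link_unique T"
    and targets: "\<And>v. v \<in> M \<Longrightarrow> \<exists>x\<in>X. reaches T K x v"
  obtains P H where "P \<subseteq> T" "oriented P" "M \<subseteq> H"
    "\<And>e a b. (e, a, b) \<in> P \<Longrightarrow> a \<in> H \<and> b \<in> H \<and> b \<notin> X"
    "\<And>x. x \<in> H \<Longrightarrow> \<exists>x0\<in>X \<inter> H. \<exists>v\<in>M. \<exists>i j. reaches P i x0 x \<and> reaches P j x v \<and> i + j \<le> K"
proof -
  define E where "E = snd ` T"
  define reachable where "reachable x \<longleftrightarrow> (\<exists>n. \<exists>x0\<in>X. (x0, x) \<in> E ^^ n)" for x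
  \<comment> \<open>\<open>dist\<close> is informative on reachable vertices only; elsewhere
    \<open>LEAST\<close> has no witness.\<close>
  define dist where "dist x = (LEAST n. \<exists>x0\<in>X. (x0, x) \<in> E ^^ n)" for x
  have dist_le: "dist x \<le> n" if "x0 \<in> X" "(x0, x) \<in> E ^^ n" for x0 x n
    unfolding dist_def using that by (intro Least_le) auto
  have dist_ex: "\<exists>x0\<in>X. (x0, x) \<in> E ^^ dist x" if "reachable x" for x
    using that unfolding dist_def reachable_def by (rule LeastI_ex)
  have parent_ex: "\<exists>p. (fst p, snd p, x) \<in> T \<and> reachable (snd p) \<and> dist x = Suc (dist (snd p))"
    if rx: "reachable x" and nx: "x \<notin> X" for x
  proof -
    obtain x0 where x0: "x0 \<in> X" "(x0, x) \<in> E ^^ dist x"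
      using dist_ex[OF rx] by blast
    obtain n where n: "dist x = Suc n"
      using x0 nx by (cases "dist x") auto
    then obtain y where y: "(x0, y) \<in> E ^^ n" "(y, x) \<in> E"
      using x0 by auto
    then obtain e where e: "(e, y, x) \<in> T"
      unfolding E_def by auto
    have ry: "reachable y"
      using x0(1) y(1) unfolding reachable_def by blast
    obtain x1 where "x1 \<in> X" "(x1, y) \<in> E ^^ dist y"
      using dist_ex[OF ry] by blast
    then have "dist x \<le> Suc (dist y)"
      using y(2) by (intro dist_le[of x1]) auto
    moreover have "dist y \<le> n"
      using x0(1) y(1) by (rule dist_le)
    ultimately show ?thesis
      using e ry n by (intro exI[of _ "(e, y)"]) auto
  qed
  define par where
    "par x = (SOME p. (fst p, snd p, x) \<in> T \<and> reachable (snd p) \<and> dist x = Suc (dist (snd p)))"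
    for x
  have par: "(fst (par x), snd (par x), x) \<in> T \<and> reachable (snd (par x))
      \<and> dist x = Suc (dist (snd (par x)))"
    if "reachable x" "x \<notin> X" for x
    unfolding par_def by (rule someI_ex[OF parent_ex[OF that]])
  \<comment> \<open>One parent arc for each reachable vertex that is not a root; \<open>H\<close>
    and \<open>P\<close> then discard what does not lead to \<open>M\<close>.\<close>
  define F where "F = {(fst (par x), snd (par x), x) | x. reachable x \<and> x \<notin> X}"
  define H where "H = {x. reachable x \<and> (\<exists>v\<in>M. \<exists>j. (x, v) \<in> (snd ` F) ^^ j)}"
  define P where "P = {(e, a, b) \<in> F. b \<in> H}"
  have F_arc: "(e, a, b) \<in> T \<and> reachable a \<and> reachable b \<and> b \<notin> X \<and> dist b = Suc (dist a)
      \<and> par b = (e, a)"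
    if "(e, a, b) \<in> F" for e a b
    using that par unfolding F_def by auto
  have F_dist: "dist b = dist a + n" if "(a, b) \<in> (snd ` F) ^^ n" for a b n
    using that
  proof (induction n arbitrary: b)
    case (Suc n)
    then obtain c where "(a, c) \<in> (snd ` F) ^^ n" "(c, b) \<in> snd ` F"
      by auto
    then show ?case
      using Suc.IH[of c] F_arc by auto
  qed auto
  have F_up: "a \<in> H" if ab: "(e, a, b) \<in> F" and b: "b \<in> H" for e a b
  proof -
    obtain v j where "v \<in> M" "(b, v) \<in> (snd ` F) ^^ j"
      using b unfolding H_def by blast
    moreover have "(a, b) \<in> snd ` F"
      using ab by force
    ultimately have "\<exists>v\<in>M. \<exists>j. (a, v) \<in> (snd ` F) ^^ j"
      by (meson relpow_Suc_I2)
    then show ?thesis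
      using F_arc[OF ab] unfolding H_def by blast
  qed
  have F_P: "(a, b) \<in> (snd ` P) ^^ n \<and> a \<in> H" if "(a, b) \<in> (snd ` F) ^^ n" "b \<in> H" for a b n
    using that
  proof (induction n arbitrary: b)
    case (Suc n)
    then obtain c e where c: "(a, c) \<in> (snd ` F) ^^ n" "(e, c, b) \<in> F"
      by auto
    then have "(e, c, b) \<in> P" "c \<in> H"
      using Suc.prems F_up unfolding P_def by blast+
    then have "(c, b) \<in> snd ` P" "(a, c) \<in> (snd ` P) ^^ n \<and> a \<in> H"
      using Suc.IH[OF c(1)] by force+
    then show ?case
      by auto
  qed auto
  have F_root: "\<exists>x0\<in>X. (x0, x) \<in> (snd ` F) ^^ dist x \<and> reachable x0" if "reachable x" for x
    using that
  proof (induction "dist x" arbitrary: x rule: less_induct)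
    case less
    show ?case
    proof (cases "x \<in> X")
      case True
      then have "dist x = 0"
        using dist_le[of x x 0] by auto
      then show ?thesis
        using True less.prems by (intro bexI[of _ x]) auto
    next
      case False
      let ?y = "snd (par x)"
      have p: "reachable ?y" "dist x = Suc (dist ?y)"
        using par[OF less.prems False] by auto
      then obtain x0 where "x0 \<in> X" "(x0, ?y) \<in> (snd ` F) ^^ dist ?y" "reachable x0"
        using less.hyps[of ?y] by auto
      moreover have "(fst (par x), ?y, x) \<in> F"
        using False less.prems unfolding F_def by auto
      then have "(?y, x) \<in> snd ` F"
        by force
      ultimately show ?thesis
        using p(2) by (intro bexI[of _ x0]) auto
    qed
  qed
  have M_reach: "reachable v \<and> dist v \<le> K" if "v \<in> M" for v
    using targets[OF that] dist_le unfolding reaches_def reachable_def E_def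
    by (meson order_trans)
  show ?thesis
  proof
    show "P \<subseteq> T"
      using F_arc unfolding P_def by auto
    show "oriented P"
      unfolding oriented_def
    proof (intro allI impI)
      fix e p q
      assume pq: "(e, p) \<in> P \<and> (e, q) \<in> P"
      obtain a b c d where [simp]: "p = (a, b)" "q = (c, d)"
        by fastforce
      have F: "(e, a, b) \<in> F" "(e, c, d) \<in> F"
        using pq unfolding P_def by auto
      then have "(c = a \<and> d = b) \<or> (c = b \<and> d = a)"
        using F_arc uniq unfolding link_unique_def by meson
      \<comment> \<open>For reversed arcs, \<open>dist\<close> would have to increase by one in both
        directions.\<close>
      then show "p = q"
        using F_arc[OF F(1)] F_arc[OF F(2)] by auto
    qed
    show "M \<subseteq> H"
      using M_reach unfolding H_def by (blast intro: relpow_0_I)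
    show "a \<in> H \<and> b \<in> H \<and> b \<notin> X" if "(e, a, b) \<in> P" for e a b
      using that F_up F_arc unfolding P_def by blast
    show "\<exists>x0\<in>X \<inter> H. \<exists>v\<in>M. \<exists>i j. reaches P i x0 x \<and> reaches P j x v \<and> i + j \<le> K"
      if "x \<in> H" for x
    proof -
      obtain v j where v: "reachable x" "v \<in> M" "(x, v) \<in> (snd ` F) ^^ j"
        using \<open>x \<in> H\<close> unfolding H_def by blast
      obtain x0 where x0: "x0 \<in> X" "(x0, x) \<in> (snd ` F) ^^ dist x"
        using F_root[OF v(1)] by blast
      have "v \<in> H"
        using v(2) \<open>M \<subseteq> H\<close> by blast
      then have "(x, v) \<in> (snd ` P) ^^ j" "(x0, x) \<in> (snd ` P) ^^ dist x" "x0 \<in> H"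
        using F_P v(3) x0(2) \<open>x \<in> H\<close> by blast+
      moreover have "dist x + j \<le> K"
        using F_dist[OF v(3)] M_reach[OF v(2)] by simp
      ultimately show ?thesis
        using x0(1) v(2) unfolding reaches_def by blast
    qed
  qed
qed

section \<open>One layer\<close>

definition interior :: "('e, 'v) arcs \<Rightarrow> 'v set \<Rightarrow> ('e, 'v) arcs" where
  "interior T W = {(e, a, b) \<in> T. a \<notin> W \<and> b \<notin> W}"

definition exits :: "('e, 'v) arcs \<Rightarrow> 'v set \<Rightarrow> 'e \<Rightarrow> 'v \<Rightarrow> bool" where
  "exits T W e y \<longleftrightarrow> y \<notin> W \<and> (\<exists>w\<in>W. (e, w, y) \<in> T)"

definition enters :: "('e, 'v) arcs \<Rightarrow> 'v set \<Rightarrow> 'e \<Rightarrow> 'v \<Rightarrow> bool" where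
  "enters T W e y \<longleftrightarrow> y \<notin> W \<and> (\<exists>w\<in>W. (e, y, w) \<in> T)"

lemma interior_opposite: "interior (opposite T) W = opposite (interior T W)"
  unfolding interior_def opposite_def by auto

lemma exits_opposite: "exits (opposite T) W e y \<longleftrightarrow> enters T W e y"
  unfolding exits_def enters_def by auto

text \<open>Cut the walk at its last departure from \<open>W\<close>: everything afterwards stays
  outside. The departing arc itself is used up, hence \<open>m < n\<close>.\<close>

lemma first_exit_relpow:
  assumes "(w, x) \<in> (snd ` T) ^^ n" "w \<in> W" "x \<notin> W"
  shows "\<exists>e y m. exits T W e y \<and> m < n \<and> (y, x) \<in> (snd ` interior T W) ^^ m"
  using assms
proof (induction n arbitrary: x)
  case (Suc n)
  then obtain c e where c: "(w, c) \<in> (snd ` T) ^^ n" "(e, c, x) \<in> T"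
    by auto
  show ?case
  proof (cases "c \<in> W")
    case True
    then have "exits T W e x"
      using c(2) Suc.prems unfolding exits_def by blast
    then show ?thesis
      by (intro exI[of _ e] exI[of _ x] exI[of _ 0]) auto
  next
    case False
    then obtain f y m where m: "exits T W f y" "m < n" "(y, c) \<in> (snd ` interior T W) ^^ m"
      using Suc.IH[OF c(1)] Suc.prems by blast
    have "(e, c, x) \<in> interior T W"
      using c(2) False Suc.prems unfolding interior_def by blast
    then have "(c, x) \<in> snd ` interior T W"
      by force
    then have "(y, x) \<in> (snd ` interior T W) ^^ Suc m"
      using m(3) by auto
    then show ?thesis
      using m(1,2) by (meson Suc_mono)
  qed
qed auto

lemma first_exit:
  assumes "w \<in> W" "reaches T (Suc k) w x" "x \<notin> W"
  shows "\<exists>e y. exits T W e y \<and> reaches (interior T W) k y x"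
proof -
  obtain n where n: "n \<le> Suc k" "(w, x) \<in> (snd ` T) ^^ n"
    using assms(2) unfolding reaches_def by blast
  obtain e y m where "exits T W e y" "m < n" "(y, x) \<in> (snd ` interior T W) ^^ m"
    using first_exit_relpow[OF n(2) assms(1,3)] by blast
  then show ?thesis
    using n(1) unfolding reaches_def by (metis less_Suc_eq_le order_less_le_trans)
qed

text \<open>Reversing all arcs turns the last departure from \<open>W\<close> into the first arrival
  in \<open>W\<close>.\<close>

lemma last_entry:
  assumes "w \<in> W" "reaches T (Suc k) x w" "x \<notin> W"
  shows "\<exists>e y. enters T W e y \<and> reaches (interior T W) k x y"
  using first_exit[of w W "opposite T" k x] assms by (simp add: exits_opposite interior_opposite)

text \<open>One round of the construction with core \<open>W\<close>. Distances to and from the core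
  are at most \<open>k + 1\<close>: one arc crosses the boundary and at most \<open>k\<close> stay
  outside. A label with arcs both ways is an undirected edge, so \<open>no_bridge\<close> speaks of
  undirected edges other than loops.\<close>

locale layer =
  fixes T :: "('e, 'v) arcs" and V W :: "'v set" and k :: nat
  assumes finite_T: "finite T"
    and uniq: "link_unique T"
    and T_V: "(e, a, b) \<in> T \<Longrightarrow> a \<in> V \<and> b \<in> V"
    and no_bridge: "(e, a, b) \<in> T \<Longrightarrow> (e, b, a) \<in> T \<Longrightarrow> a \<noteq> b \<Longrightarrow> x \<in> V \<Longrightarrow> y \<in> V \<Longrightarrow>
      \<exists>n. reaches {t \<in> T. fst t \<noteq> e} n x y"
    and W_V: "W \<subseteq> V"
    and from_W: "x \<in> V - W \<Longrightarrow> \<exists>e y. exits T W e y \<and> reaches (interior T W) k y x"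
    and to_W: "x \<in> V - W \<Longrightarrow> \<exists>e y. enters T W e y \<and> reaches (interior T W) k x y"
begin

section \<open>Ears at the boundary of the core\<close>

abbreviation "N \<equiv> interior T W"

text \<open>An ear of length at most \<open>2 * k + 3\<close> that starts, respectively ends, with the edge \<open>e\<close>.\<close>

definition out_ear :: "'e \<Rightarrow> bool" where
  "out_ear e \<longleftrightarrow> (\<exists>v y g. exits T W e v \<and> reaches N (2 * k + 1) v y \<and> enters T W g y \<and> g \<noteq> e)"

definition in_ear :: "'e \<Rightarrow> bool" where
  "in_ear e \<longleftrightarrow> (\<exists>v y g. enters T W e v \<and> exits T W g y \<and> g \<noteq> e \<and> reaches N (2 * k + 1) y v)"

lemma exits_unique: "exits T W e y \<Longrightarrow> exits T W e z \<Longrightarrow> y = z"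
  using uniq unfolding exits_def link_unique_def by metis

lemma enters_unique: "enters T W e y \<Longrightarrow> enters T W e z \<Longrightarrow> y = z"
  using uniq unfolding enters_def link_unique_def by metis

lemma exits_enters_unique: "exits T W e y \<Longrightarrow> enters T W e z \<Longrightarrow> y = z"
  using uniq unfolding exits_def enters_def link_unique_def by metis

lemma exits_V: "exits T W e y \<Longrightarrow> y \<in> V - W"
  using T_V unfolding exits_def by blast

lemma enters_V: "enters T W e y \<Longrightarrow> y \<in> V - W"
  using T_V unfolding enters_def by blast

lemma interior_subset: "N \<subseteq> T"
  unfolding interior_def by auto

lemma interior_V: "(e, a, b) \<in> N \<Longrightarrow> a \<in> V - W \<and> b \<in> V - W"
  using T_V unfolding interior_def by blast

lemma reaches_interior_V: "reaches N n x y \<Longrightarrow> x \<in> V - W \<Longrightarrow> y \<in> V - W"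
proof -
  have "y \<in> V - W" if "(x, y) \<in> (snd ` N) ^^ m" "x \<in> V - W" for m
    using that
  proof (induction m arbitrary: y)
    case (Suc m)
    then obtain c e where "(e, c, y) \<in> N"
      by auto
    then show ?case
      using interior_V by blast
  qed auto
  then show "reaches N n x y \<Longrightarrow> x \<in> V - W \<Longrightarrow> y \<in> V - W"
    unfolding reaches_def by blast
qed

text \<open>Follow a walk from \<open>w\<close> to \<open>v\<close> that avoids \<open>e\<close>,
  which exists because \<open>e\<close> is no bridge. Without ears at \<open>e\<close>, every vertex
  of this walk outside \<open>W\<close> stays close to an exit other than \<open>e\<close> (property
  \<open>A\<close>). At \<open>v\<close> itself this yields an in-ear.\<close>

lemma ear_exists:
  assumes e: "exits T W e v" "enters T W e v"
  shows "out_ear e \<or> in_ear e"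
proof (rule ccontr)
  assume contra: "\<not> (out_ear e \<or> in_ear e)"
  define A where "A x \<longleftrightarrow> (\<exists>g y. exits T W g y \<and> g \<noteq> e \<and> reaches N k y x)" for x
  define C where "C x \<longleftrightarrow> (\<exists>g y. enters T W g y \<and> g \<noteq> e \<and> reaches N k x y)" for x
  have A_or: "A x \<or> reaches N k v x" if "x \<in> V - W" for x
    using from_W[OF that] exits_unique e(1) unfolding A_def by metis
  have C_or: "C x \<or> reaches N k x v" if "x \<in> V - W" for x
    using to_W[OF that] enters_unique e(2) unfolding C_def by metis
  have no_in: False if "exits T W g y" "g \<noteq> e" "reaches N (2 * k + 1) y v" for g y
    using contra that e(2) unfolding in_ear_def by blast
  have no_out: False if "enters T W g y" "g \<noteq> e" "reaches N (2 * k + 1) v y" for g y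
    using contra that e(1) unfolding out_ear_def by blast
  have AD: False if "A x" "reaches N k x v" for x
  proof -
    obtain g y where "exits T W g y" "g \<noteq> e" "reaches N k y x"
      using \<open>A x\<close> unfolding A_def by blast
    then show False
      using no_in reaches_trans[of N k y x k v "2 * k + 1"] \<open>reaches N k x v\<close> by auto
  qed
  have CB: False if "C x" "reaches N k v x" for x
  proof -
    obtain g y where "enters T W g y" "g \<noteq> e" "reaches N k x y"
      using \<open>C x\<close> unfolding C_def by blast
    then show False
      using no_out reaches_trans[of N k v x k y "2 * k + 1"] \<open>reaches N k v x\<close> by auto
  qed
  obtain w where w: "w \<in> W" "(e, w, v) \<in> T" "v \<notin> W"
    using e(1) unfolding exits_def by blast
  then have "(e, v, w) \<in> T"
    using e(2) uniq unfolding enters_def link_unique_def by metis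
  then obtain n where n: "(w, v) \<in> (snd ` {t \<in> T. fst t \<noteq> e}) ^^ n"
    using no_bridge[OF w(2)] T_V w unfolding reaches_def by blast
  have "x \<in> W \<or> A x" if "(w, x) \<in> (snd ` {t \<in> T. fst t \<noteq> e}) ^^ n" for x n
    using that
  proof (induction n arbitrary: x)
    case (Suc n)
    then obtain c f where c: "(w, c) \<in> (snd ` {t \<in> T. fst t \<noteq> e}) ^^ n"
      "(f, c, x) \<in> T" "f \<noteq> e"
      by auto
    show ?case
    proof (cases "x \<in> W")
      case False
      have x: "x \<in> V - W"
        using False c(2) T_V by blast
      show ?thesis
      proof (cases "c \<in> W")
        case True
        then have "exits T W f x"
          using c(2) False unfolding exits_def by blast
        then show ?thesis
          using c(3) unfolding A_def by (meson reaches_refl)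
      next
        case cW: False
        then have "A c"
          using Suc.IH[OF c(1)] by blast
        then obtain g y where g: "exits T W g y" "g \<noteq> e" "reaches N k y c"
          unfolding A_def by blast
        have "(f, c, x) \<in> N"
          using c(2) cW False unfolding interior_def by blast
        then have "reaches N (k + 1) y x"
          using g(3) reaches_trans[of N k y c 1 x "k + 1"] reaches_arc[of f c x N 1] by auto
        \<comment> \<open>The bound \<open>2 * k + 1\<close> is exactly \<open>(k + 1) + k\<close>:
          the step from \<open>c\<close> to \<open>x\<close> costs one. Being far from
          \<open>v\<close> forces \<open>C x\<close>, which by \<open>CB\<close> excludes short
          access from \<open>v\<close> and so restores \<open>A x\<close>.\<close>
        then have "\<not> reaches N k x v"
          using g no_in reaches_trans[of N "k + 1" y x k v "2 * k + 1"] by auto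
        then have "C x"
          using C_or x by blast
        then show ?thesis
          using CB A_or x by blast
      qed
    qed auto
  qed (use w in auto)
  then have "A v"
    using n w by blast
  then show False
    by (rule AD[OF _ reaches_refl])
qed

section \<open>Choosing the edges oriented into the core\<close>

text \<open>The two cases are the undirected edges selected by \<open>S\<close> and the directed
  edges into \<open>W\<close>, which leave no choice.\<close>

definition inward_edge :: "'e set \<Rightarrow> 'e \<Rightarrow> 'v \<Rightarrow> bool" where
  "inward_edge S e v \<longleftrightarrow> enters T W e v \<and> (e \<in> S \<or> \<not> exits T W e v)"

text \<open>Edges of \<open>S\<close> will point inwards and so cannot serve as starts
  \<open>g\<close>. One crossing arc and \<open>2 * k + 1\<close> interior steps keep the outer ends
  of inward edges within \<open>2 * k + 2\<close> of \<open>W\<close>.\<close>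

definition admissible :: "'e set \<Rightarrow> bool" where
  "admissible S \<longleftrightarrow>
    S \<subseteq> {e. \<exists>v. exits T W e v \<and> enters T W e v} \<and>
    (\<forall>e v. inward_edge S e v \<longrightarrow>
      (\<exists>g y. exits T W g y \<and> g \<notin> S \<and> reaches N (2 * k + 1) y v))"

text \<open>Exchanging an edge that has an out-ear for one that has none raises the weight.\<close>

definition weight :: "'e set \<Rightarrow> nat" where
  "weight S = card S + card (S \<inter> {e. \<not> out_ear e})"

lemma admissible_finite: "admissible S \<Longrightarrow> finite S"
proof -
  assume "admissible S"
  then have "S \<subseteq> fst ` T"
    unfolding admissible_def exits_def by force
  then show "finite S"
    using finite_T finite_subset by blast
qed

text \<open>If nothing is selected, every exit may serve as a start, and \<open>from_W\<close>
  suffices. This gives the search for a maximum its first candidate.\<close>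

lemma admissible_empty: "admissible {}"
  unfolding admissible_def inward_edge_def
  using from_W enters_V reaches_mono[of N k _ _ N "2 * k + 1"] by (simp, meson order_refl)

lemma maximal_admissible:
  obtains S where "admissible S" "\<And>S'. admissible S' \<Longrightarrow> weight S' \<le> weight S"
proof -
  have "weight S < Suc (2 * card (fst ` T))" if "admissible S" for S
  proof -
    have "S \<subseteq> fst ` T"
      using that unfolding admissible_def exits_def by force
    then have "card S \<le> card (fst ` T)" "card (S \<inter> {e. \<not> out_ear e}) \<le> card (fst ` T)"
      using finite_T by (auto intro!: card_mono)
    then show ?thesis
      unfolding weight_def by simp
  qed
  then show ?thesis
    using ex_has_greatest_nat[of admissible "{}" weight] admissible_empty that by blast
qed

text \<open>\<open>P1\<close> is a forest from the ends of outward edges to the ends of inward ones.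
  Maximality of the weight yields the last conclusion: a boundary vertex outside \<open>H1\<close>
  without a short way into \<open>H1\<close> would allow an insertion into \<open>S\<close> or an
  exchange.\<close>

lemma layer_cover:
  obtains S P1 H1 where
    "admissible S"
    "P1 \<subseteq> N" "oriented P1" "H1 \<subseteq> V - W"
    "\<And>e a b. (e, a, b) \<in> P1 \<Longrightarrow> a \<in> H1 \<and> b \<in> H1"
    "\<And>e v. inward_edge S e v \<Longrightarrow> v \<in> H1"
    "\<And>x. x \<in> H1 \<Longrightarrow> \<exists>g y e v. exits T W g y \<and> g \<notin> S \<and> reaches P1 (2 * k + 1) y x
      \<and> inward_edge S e v \<and> reaches P1 (2 * k + 1) x v"
    "\<And>e v. v \<notin> H1 \<Longrightarrow> exits T W e v \<or> enters T W e v \<Longrightarrow>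
      e \<notin> S \<and> exits T W e v \<and> (\<exists>h\<in>H1. reaches N (2 * k + 1) v h)"
proof -
  obtain S where S: "admissible S" and S_max: "\<And>S'. admissible S' \<Longrightarrow> weight S' \<le> weight S"
    using maximal_admissible by blast
  \<comment> \<open>Roots are the outer ends of edges available for leaving \<open>W\<close>;
    targets are the outer ends of inward edges. A path of the forest thus completes to an
    ear.\<close>
  define X where "X = {y. \<exists>g. exits T W g y \<and> g \<notin> S}"
  define M where "M = {v. \<exists>e. inward_edge S e v}"
  have "\<exists>x\<in>X. reaches N (2 * k + 1) x v" if "v \<in> M" for v
    using that S unfolding X_def M_def admissible_def by blast
  then obtain P H where P: "P \<subseteq> N" "oriented P" "M \<subseteq> H"
    and P_H: "\<And>e a b. (e, a, b) \<in> P \<Longrightarrow> a \<in> H \<and> b \<in> H \<and> b \<notin> X"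
    and H: "\<And>x. x \<in> H \<Longrightarrow> \<exists>x0\<in>X \<inter> H. \<exists>v\<in>M. \<exists>i j. reaches P i x0 x \<and> reaches P j x v
      \<and> i + j \<le> 2 * k + 1"
    using shortest_path_forest[of N M X "2 * k + 1"] link_unique_subset[OF uniq interior_subset]
    by metis
  have H_V: "H \<subseteq> V - W"
  proof
    fix x assume "x \<in> H"
    then obtain x0 i where "x0 \<in> X" "reaches P i x0 x"
      using H by blast
    moreover have "x0 \<in> V - W"
      using \<open>x0 \<in> X\<close> exits_V unfolding X_def by blast
    ultimately show "x \<in> V - W"
      using reaches_interior_V reaches_mono[OF _ P(1)] by blast
  qed
  have H_source: "\<exists>g y. exits T W g y \<and> g \<notin> S \<and> y \<in> H \<and> reaches N (2 * k + 1) y x"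
    if x: "x \<in> H" for x
  proof -
    obtain y i j where y: "y \<in> X \<inter> H" "reaches P i y x" "i + j \<le> 2 * k + 1"
      using H[OF x] by blast
    then have "reaches N (2 * k + 1) y x"
      using reaches_mono[OF y(2) P(1)] by auto
    then show ?thesis
      using y(1) unfolding X_def by blast
  qed
  \<comment> \<open>Adding \<open>g\<close> to \<open>S\<close> hurts no old target: its path in the forest starts at a vertex of \<open>H\<close>,
    so it does not leave \<open>W\<close> through \<open>g\<close>.\<close>
  have insertion: False
    if g: "enters T W g z" "exits T W g z" "g \<notin> S" "z \<notin> H"
      and f: "exits T W f y" "f \<notin> S" "f \<noteq> g" "reaches N (2 * k + 1) y z" for f g y z
  proof -
    have "\<exists>g' y. exits T W g' y \<and> g' \<notin> insert g S \<and> reaches N (2 * k + 1) y v"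
      if "inward_edge (insert g S) e v" for e v
    proof (cases "e = g")
      case True
      then have "v = z"
        using that g(1) enters_unique unfolding inward_edge_def by blast
      then show ?thesis
        using f by blast
    next
      case False
      then have "v \<in> H"
        using that P(3) unfolding inward_edge_def M_def by blast
      then obtain g0 y0 where "exits T W g0 y0" "g0 \<notin> S" "y0 \<in> H" "reaches N (2 * k + 1) y0 v"
        using H_source by blast
      moreover have "g0 \<noteq> g"
        using exits_unique g(2,4) \<open>exits T W g0 y0\<close> \<open>y0 \<in> H\<close> by blast
      ultimately show ?thesis
        by blast
    qed
    then have "admissible (insert g S)"
      using S g unfolding admissible_def by blast
    then have "weight (insert g S) \<le> weight S"
      by (rule S_max)
    moreover have "card (S \<inter> {e. \<not> out_ear e}) \<le> card (insert g S \<inter> {e. \<not> out_ear e})"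
      using admissible_finite[OF S] by (intro card_mono) auto
    ultimately show False
      using admissible_finite[OF S] g(3) unfolding weight_def by simp
  qed
  \<comment> \<open>If \<open>y\<close> were outside \<open>H\<close>, then \<open>g\<close> would
    be undirected and not in \<open>S\<close>, and the way from \<open>e\<close> to \<open>y\<close>
    would permit its insertion.\<close>
  have ear_end: "y \<in> H"
    if "exits T W e v" "e \<notin> S" "reaches N (2 * k + 1) v y" "enters T W g y" "g \<noteq> e" for e v g y
  proof (rule ccontr)
    assume "y \<notin> H"
    then have "\<not> inward_edge S g y"
      using P(3) unfolding M_def by blast
    then show False
      using that insertion[of g y e v] \<open>y \<notin> H\<close> unfolding inward_edge_def by blast
  qed
  have outside: "e \<notin> S \<and> exits T W e v \<and> (\<exists>h\<in>H. reaches N (2 * k + 1) v h)"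
    if v: "v \<notin> H" and ev: "exits T W e v \<or> enters T W e v" for e v
  proof -
    have v_M: "\<not> inward_edge S e' v" for e'
      using v P(3) unfolding M_def by blast
    then have e_exits: "exits T W e v"
      using ev unfolding inward_edge_def by blast
    have e_S: "e \<notin> S"
    proof
      assume "e \<in> S"
      then have "enters T W e v"
        using S e_exits exits_enters_unique exits_unique unfolding admissible_def by blast
      then show False
        using v_M \<open>e \<in> S\<close> unfolding inward_edge_def by blast
    qed
    have "\<exists>h\<in>H. reaches N (2 * k + 1) v h"
    proof (cases "enters T W e v")
      case False
      obtain g y where g: "enters T W g y" "reaches N k v y"
        using to_W exits_V[OF e_exits] by blast
      have "reaches N (2 * k + 1) v y"
        using reaches_mono[OF g(2)] by simp
      \<comment> \<open>Here \<open>e\<close> is directed out of \<open>W\<close>, so any return to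
        \<open>W\<close> uses a different edge.\<close>
      moreover have "g \<noteq> e"
        using False g(1) e_exits exits_enters_unique by blast
      ultimately show ?thesis
        using ear_end e_exits e_S g(1) by blast
    next
      case e_enters: True
      show ?thesis
      proof (cases "out_ear e")
        case True
        then show ?thesis
          using ear_end e_exits e_S exits_unique unfolding out_ear_def by metis
      next
        case False
        then obtain g y where g: "exits T W g y" "g \<noteq> e" "reaches N (2 * k + 1) y v"
          using ear_exists[OF e_exits e_enters] enters_unique e_enters unfolding in_ear_def by metis
        \<comment> \<open>Otherwise \<open>g\<close> would be an available start, and
          \<open>e\<close> could be inserted.\<close>
        have g_S: "g \<in> S"
          using insertion[OF e_enters e_exits e_S v] g by blast
        \<comment> \<open>The in-ear of \<open>e\<close> starts with \<open>g\<close>, so the same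
          ear is an out-ear of \<open>g\<close>.\<close>
        then have "g \<noteq> e" "out_ear g"
          using g e_enters unfolding out_ear_def by blast+
        \<comment> \<open>The exchange: \<open>g\<close>, now free to point outwards, provides the
          path to \<open>v\<close>. Other targets keep their starts, which lie in \<open>H\<close>
          and therefore do not use \<open>e\<close>. The size is unchanged and the number of edges
          without out-ear rises by one.\<close>
        let ?S = "insert e (S - {g})"
        have "\<exists>g' y. exits T W g' y \<and> g' \<notin> ?S \<and> reaches N (2 * k + 1) y v'"
          if "inward_edge ?S e' v'" for e' v'
        proof (cases "e' = e")
          case True
          then have "v' = v"
            using that e_enters enters_unique unfolding inward_edge_def by blast
          then show ?thesis
            using g by blast
        next
          case False
          then have "v' \<in> H"
            using that P(3) unfolding inward_edge_def M_def by blast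
          then obtain g0 y0 where "exits T W g0 y0" "g0 \<notin> S" "y0 \<in> H"
            "reaches N (2 * k + 1) y0 v'"
            using H_source by blast
          moreover have "g0 \<noteq> e"
            using exits_unique v e_exits \<open>exits T W g0 y0\<close> \<open>y0 \<in> H\<close> by blast
          ultimately show ?thesis
            by blast
        qed
        then have "admissible ?S"
          using S e_enters e_exits unfolding admissible_def by blast
        then have "weight ?S \<le> weight S"
          by (rule S_max)
        moreover have "card ?S = card S"
          using admissible_finite[OF S] g_S e_S by (metis card.insert_remove card_Suc_Diff1
            finite_Diff insert_Diff_single Diff_iff card_insert_disjoint)
        moreover have "?S \<inter> {e. \<not> out_ear e} = insert e (S \<inter> {e. \<not> out_ear e})"
          using False \<open>out_ear g\<close> by auto
        then have "card (?S \<inter> {e. \<not> out_ear e}) = Suc (card (S \<inter> {e. \<not> out_ear e}))"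
          using admissible_finite[OF S] e_S by simp
        ultimately show ?thesis
          unfolding weight_def by simp
      qed
    qed
    then show ?thesis
      using e_S e_exits by blast
  qed
  show ?thesis
  proof (rule that[of S P H])
    show "\<exists>g y e v. exits T W g y \<and> g \<notin> S \<and> reaches P (2 * k + 1) y x
      \<and> inward_edge S e v \<and> reaches P (2 * k + 1) x v" if x: "x \<in> H" for x
    proof -
      obtain y v i j where y: "y \<in> X \<inter> H" "v \<in> M" "reaches P i y x" "reaches P j x v"
        "i + j \<le> 2 * k + 1"
        using H[OF x] by blast
      then have "reaches P (2 * k + 1) y x" "reaches P (2 * k + 1) x v"
        using reaches_mono[OF y(3) order_refl] reaches_mono[OF y(4) order_refl] by auto
      then show ?thesis
        using y(1,2) unfolding X_def M_def by blast
    qed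
    show "v \<in> H" if "inward_edge S e v" for e v
      using that P(3) unfolding M_def by blast
  qed (use S P H_V P_H outside in blast)+
qed

text \<open>Two forests together contain all neighbours of \<open>W\<close>: \<open>P1\<close>
  supplies ways from and to \<open>W\<close>, and \<open>P2\<close> leads the remaining neighbours
  into \<open>P1\<close>. The boundary edges are oriented according to \<open>S\<close>.\<close>

lemma layer_step:
  obtains W' Q where
    "W \<subseteq> W'" "W' \<subseteq> V" "Q \<subseteq> T" "oriented Q"
    "\<And>e a b. (e, a, b) \<in> Q \<Longrightarrow> a \<in> W' \<and> b \<in> W' \<and> (a \<notin> W \<or> b \<notin> W)"
    "\<And>e v. exits T W e v \<or> enters T W e v \<Longrightarrow> v \<in> W'"
    "\<And>x. x \<in> W' - W \<Longrightarrow> \<exists>w\<in>W. reaches Q (2 * k + 2) w x"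
    "\<And>x. x \<in> W' - W \<Longrightarrow> \<exists>w\<in>W. reaches Q (4 * k + 3) x w"
proof -
  obtain S P1 H1 where S: "admissible S" and P1: "P1 \<subseteq> N" "oriented P1" and H1_V: "H1 \<subseteq> V - W"
    and P1_H1: "\<And>e a b. (e, a, b) \<in> P1 \<Longrightarrow> a \<in> H1 \<and> b \<in> H1"
    and inward: "\<And>e v. inward_edge S e v \<Longrightarrow> v \<in> H1"
    and H1: "\<And>x. x \<in> H1 \<Longrightarrow> \<exists>g y e v. exits T W g y \<and> g \<notin> S \<and> reaches P1 (2 * k + 1) y x
      \<and> inward_edge S e v \<and> reaches P1 (2 * k + 1) x v"
    and outside: "\<And>e v. v \<notin> H1 \<Longrightarrow> exits T W e v \<or> enters T W e v \<Longrightarrow>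
      e \<notin> S \<and> exits T W e v \<and> (\<exists>h\<in>H1. reaches N (2 * k + 1) v h)"
    by (rule layer_cover) (rule that; assumption)
  define M where "M = {v. v \<notin> H1 \<and> (\<exists>e. exits T W e v)}"
  \<comment> \<open>The second forest grows from \<open>H1\<close> in the reversed interior, so that
    its reversal \<open>P2\<close> runs from \<open>M\<close> to \<open>H1\<close>.\<close>
  have "\<exists>h\<in>H1. reaches (opposite N) (2 * k + 1) h v" if "v \<in> M" for v
    using that outside unfolding M_def by (simp, blast)
  moreover have "link_unique (opposite N)"
    using link_unique_subset[OF uniq interior_subset] by simp
  ultimately obtain P H2 where P: "P \<subseteq> opposite N" "oriented P" "M \<subseteq> H2"
    and P_H2: "\<And>e a b. (e, a, b) \<in> P \<Longrightarrow> a \<in> H2 \<and> b \<in> H2 \<and> b \<notin> H1"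
    and H2: "\<And>x. x \<in> H2 \<Longrightarrow> \<exists>h\<in>H1 \<inter> H2. \<exists>v\<in>M. \<exists>i j. reaches P i h x \<and> reaches P j x v
      \<and> i + j \<le> 2 * k + 1"
    using shortest_path_forest[of "opposite N" M H1 "2 * k + 1"] by blast
  define P2 where "P2 = opposite P"
  have P2_N: "P2 \<subseteq> N"
    using opposite_mono[OF P(1)] unfolding P2_def by simp
  \<comment> \<open>A directed edge into \<open>W\<close> is recognised by its missing reverse arc;
    an undirected one points inwards only if it is in \<open>S\<close>.\<close>
  define cross where "cross = {(e, a, b) \<in> T. a \<in> W \<and> b \<notin> W \<and> e \<notin> S}
    \<union> {(e, a, b) \<in> T. a \<notin> W \<and> b \<in> W \<and> (e \<in> S \<or> (e, b, a) \<notin> T)}"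
  define Q where "Q = cross \<union> P1 \<union> P2"
  define W' where "W' = W \<union> H1 \<union> H2"
  have cross_exit: "\<exists>w\<in>W. reaches Q 1 w y" if "exits T W e y" "e \<notin> S" for e y
    using that unfolding exits_def Q_def cross_def
    by (auto intro!: reaches_arc[of e])
  have exits_rev: "exits T W e v" if "(e, w, v) \<in> T" "w \<in> W" "v \<notin> W" for e w v
    using that unfolding exits_def by blast
  have cross_enter: "\<exists>w\<in>W. reaches Q 1 v w" if ev: "inward_edge S e v" for e v
  proof -
    obtain w where w: "w \<in> W" "(e, v, w) \<in> T" "v \<notin> W"
      using ev unfolding inward_edge_def enters_def by blast
    then have "(e, v, w) \<in> cross"
      using ev exits_rev unfolding inward_edge_def cross_def by blast
    then show ?thesis
      using w(1) reaches_arc[of e v w Q 1] unfolding Q_def by auto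
  qed
  have H2_V: "H2 \<subseteq> V - W"
  proof
    fix x assume "x \<in> H2"
    then obtain v j where v: "v \<in> M" "reaches P j x v"
      using H2 by blast
    then have "reaches P2 j v x"
      unfolding P2_def by simp
    then show "x \<in> V - W"
      using reaches_interior_V[OF reaches_mono[OF _ P2_N order_refl]] v(1) exits_V
      unfolding M_def by blast
  qed
  have from_H1: "\<exists>w\<in>W. reaches Q (2 * k + 2) w x" "\<exists>w\<in>W. reaches Q (2 * k + 2) x w"
    if x: "x \<in> H1" for x
  proof -
    obtain g y e v where y: "exits T W g y" "g \<notin> S" "reaches P1 (2 * k + 1) y x"
      and v: "inward_edge S e v" "reaches P1 (2 * k + 1) x v"
      using H1[OF x] by blast
    have P1_Q: "P1 \<subseteq> Q"
      unfolding Q_def by blast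
    obtain w where "w \<in> W" "reaches Q 1 w y"
      using cross_exit[OF y(1,2)] by blast
    then show "\<exists>w\<in>W. reaches Q (2 * k + 2) w x"
      using reaches_trans[OF _ reaches_mono[OF y(3) P1_Q order_refl], of 1 w "2 * k + 2"]
      by (intro bexI[of _ w]) auto
    obtain w' where "w' \<in> W" "reaches Q 1 v w'"
      using cross_enter[OF v(1)] by blast
    then show "\<exists>w\<in>W. reaches Q (2 * k + 2) x w"
      using reaches_trans[OF reaches_mono[OF v(2) P1_Q order_refl], of 1 w' "2 * k + 2"]
      by (intro bexI[of _ w']) auto
  qed
  \<comment> \<open>Coming from \<open>W\<close>: one arc to \<open>M\<close>, then
    \<open>2 * k + 1\<close> in \<open>P2\<close>. Going back: \<open>2 * k + 1\<close> to
    \<open>H1\<close>, then \<open>2 * k + 2\<close> from there.\<close>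
  have from_H2: "\<exists>w\<in>W. reaches Q (2 * k + 2) w x" "\<exists>w\<in>W. reaches Q (4 * k + 3) x w"
    if x: "x \<in> H2" for x
  proof -
    obtain h v i j where h: "h \<in> H1" "v \<in> M" "reaches P i h x" "reaches P j x v" "i + j \<le> 2 * k + 1"
      using H2[OF x] by blast
    have P2_Q: "P2 \<subseteq> Q"
      unfolding Q_def by blast
    have "reaches P2 i x h" "reaches P2 j v x"
      using h(3,4) unfolding P2_def by simp_all
    then have Q: "reaches Q (2 * k + 1) x h" "reaches Q (2 * k + 1) v x"
      using h(5) reaches_mono[OF _ P2_Q, of _ _ _ "2 * k + 1"] by simp_all
    obtain e where "exits T W e v" "e \<notin> S"
      using h(2) outside unfolding M_def by blast
    then obtain w where "w \<in> W" "reaches Q 1 w v"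
      using cross_exit by blast
    then show "\<exists>w\<in>W. reaches Q (2 * k + 2) w x"
      using reaches_trans[OF _ Q(2), of 1 w "2 * k + 2"] by (intro bexI[of _ w]) auto
    obtain w' where "w' \<in> W" "reaches Q (2 * k + 2) h w'"
      using from_H1(2)[OF h(1)] by blast
    then show "\<exists>w\<in>W. reaches Q (4 * k + 3) x w"
      using reaches_trans[OF Q(1), of "2 * k + 2" w' "4 * k + 3"] by (intro bexI[of _ w']) auto
  qed
  \<comment> \<open>Heads in the forest \<open>P\<close> avoid its source set \<open>H1\<close>, so
    each arc of \<open>P2\<close> has an end outside \<open>H1\<close>. Hence \<open>P1\<close> and
    \<open>P2\<close> share no edge.\<close>
  have P2_H: "(a \<notin> H1 \<or> b \<notin> H1) \<and> a \<in> H2 \<and> b \<in> H2 \<and> (e, a, b) \<in> N" if "(e, a, b) \<in> P2" for e a b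
    using that P_H2[of e b a] P2_N unfolding P2_def by auto
  have P1_H: "a \<in> H1 \<and> b \<in> H1 \<and> (e, a, b) \<in> N" if "(e, a, b) \<in> P1" for e a b
    using that P1_H1 P1 by blast
  have N_W: "a \<notin> W \<and> b \<notin> W \<and> (e, a, b) \<in> T" if "(e, a, b) \<in> N" for e a b
    using that unfolding interior_def by blast
  have cross_W: "(e, a, b) \<in> T \<and> (a \<in> W \<and> b \<notin> W \<and> e \<notin> S
      \<or> a \<notin> W \<and> b \<in> W \<and> (e \<in> S \<or> (e, b, a) \<notin> T))"
    if "(e, a, b) \<in> cross" for e a b
    using that unfolding cross_def by blast
  have ends: "(c = a \<and> d = b) \<or> (c = b \<and> d = a)" if "(e, a, b) \<in> T" "(e, c, d) \<in> T" for e a b c d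
    using that uniq unfolding link_unique_def by blast
  have neighbours: "v \<in> W'" if "exits T W e v \<or> enters T W e v" for e v
    using that outside[of v e] P(3) unfolding W'_def M_def by blast
  show ?thesis
  proof (rule that[of W' Q])
    show "W \<subseteq> W'" "W' \<subseteq> V"
      using W_V H1_V H2_V unfolding W'_def by blast+
    show "Q \<subseteq> T"
      using P1(1) P2_N interior_subset unfolding Q_def cross_def by blast
    show "a \<in> W' \<and> b \<in> W' \<and> (a \<notin> W \<or> b \<notin> W)" if "(e, a, b) \<in> Q" for e a b
    proof -
      consider "(e, a, b) \<in> cross" | "(e, a, b) \<in> P1" | "(e, a, b) \<in> P2"
        using \<open>(e, a, b) \<in> Q\<close> unfolding Q_def by blast
      then show ?thesis
      proof cases
        case 1
        then have "exits T W e b \<and> a \<in> W \<or> enters T W e a \<and> b \<in> W"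
          using cross_W unfolding exits_def enters_def by blast
        then show ?thesis
          using neighbours unfolding W'_def exits_def enters_def by blast
      next
        case 2
        then show ?thesis
          using P1_H N_W unfolding W'_def by blast
      next
        case 3
        then show ?thesis
          using P2_H N_W unfolding W'_def by blast
      qed
    qed
    show "oriented Q"
      unfolding oriented_def
    proof (intro allI impI)
      fix e p q
      assume pq: "(e, p) \<in> Q \<and> (e, q) \<in> Q"
      obtain a b c d where [simp]: "p = (a, b)" "q = (c, d)"
        by fastforce
      have T: "(e, a, b) \<in> T" "(e, c, d) \<in> T"
        using pq \<open>Q \<subseteq> T\<close> by auto
      have P2': "oriented P2"
        using P(2) unfolding P2_def by simp
      \<comment> \<open>Only reversed arcs can conflict. The location of the two ends puts both into
        the same one of the three sets.\<close>
      have "a = c \<and> b = d" if swap: "c = b" "d = a"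
      proof -
        have Q: "(e, a, b) \<in> cross \<union> P1 \<union> P2" "(e, b, a) \<in> cross \<union> P1 \<union> P2"
          using pq swap unfolding Q_def by auto
        then consider "(e, a, b) \<in> cross" "(e, b, a) \<in> cross"
          | "(e, a, b) \<in> P1" "(e, b, a) \<in> P1"
          | "(e, a, b) \<in> P2" "(e, b, a) \<in> P2"
          using cross_W[of e a b] cross_W[of e b a] N_W[of e a b] N_W[of e b a]
            P1_H[of e a b] P1_H[of e b a] P2_H[of e a b] P2_H[of e b a] by blast
        then show ?thesis
        proof cases
          case 1
          then show ?thesis
            using cross_W[of e a b] cross_W[of e b a] by blast
        next
          case 2
          then show ?thesis
            using P1(2) swap unfolding oriented_def by blast
        next
          case 3
          then show ?thesis
            using P2' swap unfolding oriented_def by blast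
        qed
      qed
      then show "p = q"
        using ends[OF T] by auto
    qed
    show "\<exists>w\<in>W. reaches Q (2 * k + 2) w x" if "x \<in> W' - W" for x
      using that from_H1(1) from_H2(1) unfolding W'_def by blast
    show "\<exists>w\<in>W. reaches Q (4 * k + 3) x w" if "x \<in> W' - W" for x
    proof (cases "x \<in> H1")
      case True
      then obtain w where "w \<in> W" "reaches Q (2 * k + 2) x w"
        using from_H1(2) by blast
      then show ?thesis
        using reaches_mono[of Q "2 * k + 2" x w Q "4 * k + 3"] by auto
    qed (use that from_H2(2) in \<open>auto simp: W'_def\<close>)
  qed (use neighbours in blast)
qed

end

section \<open>Iterating over the layers\<close>

text \<open>Induction on the radius. A layer with \<open>r = k + 1\<close> adds \<open>2 * r\<close>
  to \<open>A\<close> and \<open>4 * r - 1\<close> to \<open>B\<close>, which are the increments of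
  \<open>r^2 + r\<close> and \<open>2 * r^2 + r\<close>. At radius 0 the core contains all of
  \<open>V\<close>.\<close>

lemma orient_around_core:
  fixes T :: "('e, 'v) arcs"
  assumes finite_T: "finite T" and uniq: "link_unique T"
    and T_V: "\<And>e a b. (e, a, b) \<in> T \<Longrightarrow> a \<in> V \<and> b \<in> V"
    and no_bridge: "\<And>e a b x y. (e, a, b) \<in> T \<Longrightarrow> (e, b, a) \<in> T \<Longrightarrow> a \<noteq> b \<Longrightarrow> x \<in> V \<Longrightarrow> y \<in> V \<Longrightarrow>
      \<exists>n. reaches {t \<in> T. fst t \<noteq> e} n x y"
    and "W \<subseteq> V" "R \<subseteq> T" "oriented R"
    and "\<And>e a b. (e, a, b) \<in> R \<Longrightarrow> a \<in> W \<and> b \<in> W"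
    and "\<And>x. x \<in> V \<Longrightarrow> \<exists>w\<in>W. reaches T r w x"
    and "\<And>x. x \<in> V \<Longrightarrow> \<exists>w\<in>W. reaches T r x w"
    and "\<And>w. w \<in> W \<Longrightarrow> reaches R A u w"
    and "\<And>w. w \<in> W \<Longrightarrow> reaches R B w u"
  shows "\<exists>R'\<subseteq>T. oriented R' \<and>
    (\<forall>x\<in>V. reaches R' (A + r\<^sup>2 + r) u x \<and> reaches R' (B + 2 * r\<^sup>2 + r) x u)"
  using assms(5-)
proof (induction r arbitrary: W R A B)
  case 0
  have "x \<in> W" if "x \<in> V" for x
    using 0(5)[OF that] unfolding reaches_def by auto
  then show ?case
    using 0 by (intro exI[of _ R]) auto
next
  case (Suc k)
  have from_W: "\<exists>e y. exits T W e y \<and> reaches (interior T W) k y x" if "x \<in> V - W" for x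
    using Suc.prems(5) first_exit that by (metis DiffE)
  have to_W: "\<exists>e y. enters T W e y \<and> reaches (interior T W) k x y" if "x \<in> V - W" for x
    using Suc.prems(6) last_entry that by (metis DiffE)
  interpret layer T V W k
    using finite_T uniq T_V no_bridge Suc.prems(1) from_W to_W by unfold_locales
  obtain W' Q where W': "W \<subseteq> W'" "W' \<subseteq> V" and Q: "Q \<subseteq> T" "oriented Q"
    and Q_W': "\<And>e a b. (e, a, b) \<in> Q \<Longrightarrow> a \<in> W' \<and> b \<in> W' \<and> (a \<notin> W \<or> b \<notin> W)"
    and nb: "\<And>e v. exits T W e v \<or> enters T W e v \<Longrightarrow> v \<in> W'"
    and outQ: "\<And>x. x \<in> W' - W \<Longrightarrow> \<exists>w\<in>W. reaches Q (2 * k + 2) w x"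
    and inQ: "\<And>x. x \<in> W' - W \<Longrightarrow> \<exists>w\<in>W. reaches Q (4 * k + 3) x w"
    using layer_step by metis
  have "\<exists>R'\<subseteq>T. oriented R' \<and>
    (\<forall>x\<in>V. reaches R' (A + (2 * k + 2) + k\<^sup>2 + k) u x
      \<and> reaches R' (B + (4 * k + 3) + 2 * k\<^sup>2 + k) x u)"
  proof (rule Suc.IH[of W' "R \<union> Q"])
    show "oriented (R \<union> Q)"
      unfolding oriented_def
    proof (intro allI impI)
      fix e p q
      assume pq: "(e, p) \<in> R \<union> Q \<and> (e, q) \<in> R \<union> Q"
      obtain a b c d where [simp]: "p = (a, b)" "q = (c, d)"
        by fastforce
      have "(e, a, b) \<in> T" "(e, c, d) \<in> T"
        using pq Q(1) Suc.prems(2) by auto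
      then have "(c = a \<and> d = b) \<or> (c = b \<and> d = a)"
        using uniq unfolding link_unique_def by blast
      \<comment> \<open>Arcs of \<open>R\<close> lie inside \<open>W\<close>, while those of
        \<open>Q\<close> have an end outside; two arcs of one edge have the same ends.\<close>
      then have "(e, p) \<in> R \<and> (e, q) \<in> R \<or> (e, p) \<in> Q \<and> (e, q) \<in> Q"
        using pq Suc.prems(4)[of e a b] Suc.prems(4)[of e c d] Q_W'[of e a b] Q_W'[of e c d]
        by auto
      then show "p = q"
        using Q(2) Suc.prems(3) unfolding oriented_def by blast
    qed
    show "a \<in> W' \<and> b \<in> W'" if "(e, a, b) \<in> R \<union> Q" for e a b
      using that Q_W' Suc.prems(4) W'(1) by blast
    \<comment> \<open>The end \<open>y\<close> of the crossing arc now belongs to the core, which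
      saves one step.\<close>
    show "\<exists>w\<in>W'. reaches T k w x" if xV: "x \<in> V" for x
    proof (cases "x \<in> W")
      case False
      then obtain e y where "exits T W e y" "reaches (interior T W) k y x"
        using from_W xV by blast
      then show ?thesis
        using nb reaches_mono[OF _ interior_subset order_refl] by blast
    qed (use W' in \<open>auto intro: bexI[of _ x]\<close>)
    show "\<exists>w\<in>W'. reaches T k x w" if xV: "x \<in> V" for x
    proof (cases "x \<in> W")
      case False
      then obtain e y where "enters T W e y" "reaches (interior T W) k x y"
        using to_W xV by blast
      then show ?thesis
        using nb reaches_mono[OF _ interior_subset order_refl] by blast
    qed (use W' in \<open>auto intro: bexI[of _ x]\<close>)
    show "reaches (R \<union> Q) (A + (2 * k + 2)) u x" if xW': "x \<in> W'" for x
    proof (cases "x \<in> W")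
      case True
      then show ?thesis
        using reaches_mono[OF Suc.prems(7)] by (meson Un_upper1 le_add1)
    next
      case False
      then obtain w where w: "w \<in> W" "reaches Q (2 * k + 2) w x"
        using outQ xW' by blast
      then show ?thesis
        using reaches_trans[OF reaches_mono[OF Suc.prems(7)[OF w(1)], of "R \<union> Q" A]
          reaches_mono[OF w(2), of "R \<union> Q" "2 * k + 2"]] by simp
    qed
    show "reaches (R \<union> Q) (B + (4 * k + 3)) x u" if xW': "x \<in> W'" for x
    proof (cases "x \<in> W")
      case True
      then show ?thesis
        using reaches_mono[OF Suc.prems(8)] by (meson Un_upper1 le_add1)
    next
      case False
      then obtain w where w: "w \<in> W" "reaches Q (4 * k + 3) x w"
        using inQ xW' by blast
      then show ?thesis
        using reaches_trans[OF reaches_mono[OF w(2), of "R \<union> Q" "4 * k + 3"]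
          reaches_mono[OF Suc.prems(8)[OF w(1)], of "R \<union> Q" B]] by simp
    qed
  qed (use W'(2) Q(1) Suc.prems(2) in auto)
  moreover have "A + (2 * k + 2) + k\<^sup>2 + k = A + (Suc k)\<^sup>2 + Suc k"
    "B + (4 * k + 3) + 2 * k\<^sup>2 + k = B + 2 * (Suc k)\<^sup>2 + Suc k"
    by (simp_all add: power2_eq_square)
  ultimately show ?case
    by (simp only:)
qed

section \<open>Arcs of a mixed multigraph\<close>

definition arcs_of :: "('v, 'e) pre_mixed_multigraph \<Rightarrow> ('e, 'v) arcs" where
  "arcs_of G = {(e, a, b). traverses G e a b}"

lemma arcs_of_iff [simp]: "(e, a, b) \<in> arcs_of G \<longleftrightarrow> traverses G e a b"
  unfolding arcs_of_def by simp

lemma traverses_swap: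
  "traverses G e a b \<Longrightarrow> traverses G e c d \<Longrightarrow> (c = a \<and> d = b) \<or> (c = b \<and> d = a)"
  unfolding traverses_def by auto

lemma (in mixed_multigraph) traverses_verts:
  "traverses G e a b \<Longrightarrow> a \<in> verts G \<and> b \<in> verts G"
  using link_wf[of e] unfolding traverses_def by auto

lemma (in mixed_multigraph) finite_arcs_of: "finite (arcs_of G)"
proof (rule finite_subset)
  show "arcs_of G \<subseteq> edges G \<times> verts G \<times> verts G"
    using traverses_verts unfolding arcs_of_def traverses_def by blast
qed (use finite_edges finite_verts in blast)

section \<open>Walks, paths and distances\<close>

lemma walk_reaches:
  assumes "walk G vs es"
  shows "reaches (arcs_of G) (length es) (hd vs) (last vs)"
proof -
  have len: "length vs = Suc (length es)"
    using assms unfolding walk_def by blast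
  have "(vs ! 0, vs ! i) \<in> (snd ` arcs_of G) ^^ i" if "i \<le> length es" for i
    using that
  proof (induction i)
    case (Suc i)
    then have "(es ! i, vs ! i, vs ! Suc i) \<in> arcs_of G"
      using assms unfolding walk_def by simp
    then have "(vs ! i, vs ! Suc i) \<in> snd ` arcs_of G"
      by (metis image_eqI snd_conv)
    then show ?case
      using Suc by auto
  qed auto
  moreover have "vs \<noteq> []"
    using len by auto
  moreover from this have "vs ! length es = last vs"
    using len by (simp add: last_conv_nth)
  ultimately show ?thesis
    unfolding reaches_def by (metis hd_conv_nth order_refl)
qed

text \<open>In a walk of least length a repeated vertex would allow a shortcut. A repeated edge
  would force a repeated vertex, since its link fixes its two ends.\<close>

lemma shortest_walk_is_path:
  assumes reach: "reaches (arcs_of G) n x y" and x: "x \<in> verts G"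
    and verts: "\<And>e a b. traverses G e a b \<Longrightarrow> b \<in> verts G"
  shows "\<exists>vs es. path_betw G x vs es y \<and> length es \<le> n"
proof -
  let ?R = "snd ` arcs_of G"
  define m where "m = (LEAST m. (x, y) \<in> ?R ^^ m)"
  obtain m' where m': "m' \<le> n" "(x, y) \<in> ?R ^^ m'"
    using reach unfolding reaches_def by blast
  have m: "(x, y) \<in> ?R ^^ m" "m \<le> n"
    using m' unfolding m_def by (auto intro: LeastI Least_le[THEN order_trans])
  have m_least: "m \<le> j" if "(x, y) \<in> ?R ^^ j" for j
    unfolding m_def using that by (rule Least_le)
  obtain f where f: "f 0 = x" "f m = y" "\<And>i. i < m \<Longrightarrow> (f i, f (Suc i)) \<in> ?R"
    using m(1) unfolding relpow_fun_conv by blast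
  have "\<exists>e. traverses G e (f i) (f (Suc i))" if "i < m" for i
    using f(3)[OF that] by auto
  then obtain g where g: "\<And>i. i < m \<Longrightarrow> traverses G (g i) (f i) (f (Suc i))"
    by metis
  have f_inj: "f i \<noteq> f j" if "i < j" "j \<le> m" for i j
  proof
    assume eq: "f i = f j"
    have "(x, f i) \<in> ?R ^^ i"
      unfolding relpow_fun_conv using f that by (intro exI[of _ f]) auto
    moreover have "(f j, y) \<in> ?R ^^ (m - j)"
      unfolding relpow_fun_conv using f that by (intro exI[of _ "\<lambda>l. f (j + l)"]) auto
    ultimately have "(x, y) \<in> ?R ^^ (i + (m - j))"
      using eq by (metis relpow_trans)
    then show False
      using m_least[of "i + (m - j)"] that by linarith
  qed
  have f_eq: "i = j" if "f i = f j" "i \<le> m" "j \<le> m" for i j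
    using f_inj[of i j] f_inj[of j i] that by (metis nat_neq_iff)
  have g_inj: "i = j" if ij: "g i = g j" "i < m" "j < m" for i j
  proof -
    have "(f j = f i \<and> f (Suc j) = f (Suc i)) \<or> (f j = f (Suc i) \<and> f (Suc j) = f i)"
      using g[OF ij(2)] g[OF ij(3)] ij(1) traverses_swap by metis
    then show ?thesis
      using f_eq[of j i] f_eq[of j "Suc i"] f_eq[of "Suc j" i] ij(2,3) by auto
  qed
  define vs where "vs = map f [0..<Suc m]"
  define es where "es = map g [0..<m]"
  have nth: "vs ! i = f i" if "i \<le> m" for i
    using that nth_map[of i "[0..<Suc m]" f] unfolding vs_def by (simp del: upt_Suc)
  have len: "length vs = Suc m" "length es = m"
    unfolding vs_def es_def by auto
  have f_verts: "f i \<in> verts G" if "i \<le> m" for i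
    using that x f(1) g verts by (cases i) (auto simp: Suc_le_eq)
  have "walk G vs es"
    unfolding walk_def
  proof (intro conjI allI impI)
    show "set vs \<subseteq> verts G"
      using f_verts unfolding vs_def by (auto simp del: upt_Suc)
    show "traverses G (es ! i) (vs ! i) (vs ! Suc i)" if "i < length es" for i
      using that g nth[of i] nth[of "Suc i"] len unfolding es_def by auto
  qed (use len in simp)
  moreover have "distinct es"
    using g_inj unfolding es_def distinct_map by (auto intro: inj_onI)
  moreover have "False" if "i < j" "j < length vs" "vs ! i = vs ! j" for i j
    using that nth[of i] nth[of j] f_inj[of i j] len by auto
  ultimately have "path G vs es"
    unfolding path_def trail_def by blast
  moreover have "hd vs = x" "last vs = y"
    using nth[of 0] nth[of m] f(1,2) len hd_conv_nth[of vs] last_conv_nth[of vs] by force+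
  ultimately show ?thesis
    using len(2) m(2) unfolding path_betw_def by blast
qed

lemma distance_le:
  assumes "reaches (arcs_of G) n x y" "x \<in> verts G"
    and "\<And>e a b. traverses G e a b \<Longrightarrow> b \<in> verts G"
  shows "distance G x y \<le> enat n"
proof -
  obtain vs es where "path_betw G x vs es y" "length es \<le> n"
    using shortest_walk_is_path[OF assms(1,2)] assms(3) by blast
  then show ?thesis
    unfolding distance_def by (intro Inf_lower2[of "enat (length es)"]) auto
qed

lemma reaches_of_distance_le:
  assumes "distance G x y \<le> enat n"
  shows "reaches (arcs_of G) n x y"
proof -
  \<comment> \<open>The strict inequality lets \<open>Inf_less_iff\<close> produce an actual
    path.\<close>
  have "distance G x y < enat (Suc n)"
    using assms by (simp add: order_le_less_trans)
  then obtain vs es where p: "path_betw G x vs es y" "length es < Suc n"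
    unfolding distance_def Inf_less_iff by auto
  then have "reaches (arcs_of G) (length es) x y"
    using walk_reaches unfolding path_betw_def path_def trail_def by metis
  then show ?thesis
    using p(2) reaches_mono by (metis less_Suc_eq_le order_refl)
qed

lemma (in mixed_multigraph) diameter_le_iff:
  "diameter G \<le> n \<longleftrightarrow> (\<forall>x\<in>verts G. \<forall>y\<in>verts G. distance G x y \<le> n)"
  unfolding diameter_def eccentricity_def using finite_verts verts_nonempty by auto

section \<open>Orientations\<close>

lemma (in mixed_multigraph) orientation_wf:
  assumes "orientation G H"
  shows "mixed_multigraph H"
proof
  have H: "verts H = verts G" "edges H = edges G"
    using assms unfolding orientation_def by auto
  have H_link: "case link G e of
        Undirected p \<Rightarrow> \<exists>u v. p = Upair u v \<and> link H e = Directed u v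
      | Directed u v \<Rightarrow> link H e = Directed u v" if "e \<in> edges H" for e
    using assms that H(2) unfolding orientation_def by blast
  show "finite (verts H)" "verts H \<noteq> {}" "finite (edges H)"
    using H finite_verts verts_nonempty finite_edges by auto
  show "set_link (link H e) \<subseteq> verts H" if e: "e \<in> edges H" for e
  proof (cases "link G e")
    case (Undirected p)
    then obtain a b where "p = Upair a b" "link H e = Directed a b"
      using H_link[OF e] by auto
    then show ?thesis
      using e link_wf[of e] H Undirected by simp
  next
    case (Directed a b)
    then have "link H e = Directed a b"
      using H_link[OF e] by auto
    then show ?thesis
      using e link_wf[of e] H Directed by simp
  qed
qed

lemma traverses_exists:
  assumes "e \<in> edges G"
  shows "\<exists>a b. traverses G e a b"
proof (cases "link G e")
  case (Undirected p)
  then show ?thesis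
    using assms unfolding traverses_def by (cases p) auto
qed (use assms in \<open>auto simp: traverses_def\<close>)

text \<open>Edges absent from \<open>R\<close> may take any permitted direction: further arcs never
  lengthen distances.\<close>

lemma orientation_extending:
  assumes "R \<subseteq> arcs_of G" "oriented R"
  obtains H where "orientation G H" "R \<subseteq> arcs_of H"
proof -
  have "\<exists>q. traverses G e (fst q) (snd q) \<and> (\<forall>p. (e, p) \<in> R \<longrightarrow> p = q)" if "e \<in> edges G" for e
  proof (cases "\<exists>p. (e, p) \<in> R")
    case True
    then obtain q where q: "(e, q) \<in> R"
      by blast
    then have "traverses G e (fst q) (snd q)"
      using assms(1) unfolding arcs_of_def by auto
    moreover have "p = q" if "(e, p) \<in> R" for p
      using that q assms(2) unfolding oriented_def by blast
    ultimately show ?thesis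
      by blast
  next
    case False
    then show ?thesis
      using traverses_exists[OF that] by auto
  qed
  then obtain f where f: "\<And>e. e \<in> edges G \<Longrightarrow> traverses G e (fst (f e)) (snd (f e))"
    "\<And>e p. e \<in> edges G \<Longrightarrow> (e, p) \<in> R \<Longrightarrow> p = f e"
    by metis
  let ?H = "G\<lparr>link := \<lambda>e. Directed (fst (f e)) (snd (f e))\<rparr>"
  have "orientation G ?H"
    unfolding orientation_def
  proof (intro conjI ballI)
    fix e assume "e \<in> edges G"
    then show "case link G e of
        Undirected p \<Rightarrow> \<exists>u v. p = Upair u v \<and> link ?H e = Directed u v
      | Directed u v \<Rightarrow> link ?H e = Directed u v"
      using f(1)[of e] unfolding traverses_def by (cases "link G e") auto
  qed simp_all
  moreover have "R \<subseteq> arcs_of ?H"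
  proof
    fix t assume "t \<in> R"
    obtain e a b where t: "t = (e, a, b)"
      by (cases t)
    then have e: "e \<in> edges G"
      using \<open>t \<in> R\<close> assms(1) unfolding arcs_of_def traverses_def by auto
    then show "t \<in> arcs_of ?H"
      using f(2)[OF e, of "(a, b)", symmetric] \<open>t \<in> R\<close> t by (simp add: e traverses_def)
  qed
  ultimately show thesis
    using that by blast
qed

theorem mainTheorem4:
  fixes G :: "('v, 'e) pre_mixed_multigraph" and d :: nat
  assumes "mixed_multigraph G"
    and "strongly_connected G"
    and "bridgeless G"
    and "diameter G = enat d"
  shows "oriented_diameter G \<le> enat (3 * d\<^sup>2 + 2 * d + 2)"
proof -
  interpret mixed_multigraph G
    by (rule assms(1))
  have reach: "reaches (arcs_of G) d x y" if "x \<in> verts G" "y \<in> verts G" for x y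
    using diameter_le_iff[of "enat d"] assms(4) that by (auto intro: reaches_of_distance_le)
  have uniq: "link_unique (arcs_of G)"
    using traverses_swap unfolding link_unique_def arcs_of_def by fast
  have no_bridge: "\<exists>n. reaches {t \<in> arcs_of G. fst t \<noteq> e} n x y"
    if e: "(e, a, b) \<in> arcs_of G" "(e, b, a) \<in> arcs_of G" "a \<noteq> b"
      and xy: "x \<in> verts G" "y \<in> verts G" for e a b x y
  proof (cases "x = y")
    case False
    have "e \<in> edges G" "is_Undirected (link G e)"
      using e unfolding arcs_of_def traverses_def by auto
    then have "strongly_connected (remove_edge G e)"
      using assms(3) unfolding bridgeless_def bridge_def by blast
    moreover have "x \<in> verts (remove_edge G e)" "y \<in> verts (remove_edge G e)"
      using xy unfolding remove_edge_def by simp_all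
    ultimately obtain vs es where "path_betw (remove_edge G e) x vs es y"
      using False unfolding strongly_connected_def by blast
    then have "reaches (arcs_of (remove_edge G e)) (length es) x y"
      using walk_reaches unfolding path_betw_def path_def trail_def by metis
    moreover have "arcs_of (remove_edge G e) \<subseteq> {t \<in> arcs_of G. fst t \<noteq> e}"
      unfolding arcs_of_def traverses_def remove_edge_def by auto
    ultimately show ?thesis
      using reaches_mono by (metis order_refl)
  qed auto
  obtain u where u: "u \<in> verts G"
    using verts_nonempty by blast
  \<comment> \<open>The initial core is \<open>{u}\<close> with no arcs, so
    \<open>A = B = 0\<close>, and the diameter serves as radius.\<close>
  have "\<exists>R\<subseteq>arcs_of G. oriented R \<and> (\<forall>x\<in>verts G.
      reaches R (0 + d\<^sup>2 + d) u x \<and> reaches R (0 + 2 * d\<^sup>2 + d) x u)"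
  proof (rule orient_around_core[where W = "{u}" and R = "{}"])
    show "\<exists>n. reaches {t \<in> arcs_of G. fst t \<noteq> e} n x y"
      if "(e, a, b) \<in> arcs_of G" "(e, b, a) \<in> arcs_of G" "a \<noteq> b" "x \<in> verts G" "y \<in> verts G"
      for e a b x y
      using that by (rule no_bridge)
  qed (use finite_arcs_of uniq traverses_verts u reach in \<open>auto simp: oriented_def\<close>)
  then obtain R where R: "R \<subseteq> arcs_of G" "oriented R"
    and near: "\<And>x. x \<in> verts G \<Longrightarrow> reaches R (d\<^sup>2 + d) u x \<and> reaches R (2 * d\<^sup>2 + d) x u"
    by auto
  obtain H where H: "orientation G H" "R \<subseteq> arcs_of H"
    using orientation_extending[OF R] by blast
  interpret H: mixed_multigraph H
    by (rule orientation_wf[OF H(1)])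
  have verts_H: "verts H = verts G"
    using H(1) unfolding orientation_def by blast
  have "distance H x y \<le> enat (3 * d\<^sup>2 + 2 * d + 2)" if xy: "x \<in> verts H" "y \<in> verts H" for x y
  proof (rule distance_le)
    \<comment> \<open>The route passes through \<open>u\<close>: \<open>2 * d^2 + d\<close> steps to
      it and \<open>d^2 + d\<close> from it, \<open>3 * d^2 + 2 * d\<close> in total.\<close>
    have "reaches R (3 * d\<^sup>2 + 2 * d + 2) x y"
      using near[of x] near[of y] xy verts_H by (intro reaches_trans[of R _ x u _ y]) auto
    then show "reaches (arcs_of H) (3 * d\<^sup>2 + 2 * d + 2) x y"
      using H(2) by (rule reaches_mono) simp
  qed (use xy H.traverses_verts in auto)
  then have "diameter H \<le> enat (3 * d\<^sup>2 + 2 * d + 2)"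
    using H.diameter_le_iff by blast
  then show ?thesis
    using H(1) unfolding oriented_diameter_def by (intro Inf_lower2[of "diameter H"]) auto
qed

end
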